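(* Let $P_0$ and $P$ be arbitrary probability measures on a measurable space, with densities $p_0$ and $p$ with respect to a common $\sigma$-finite dominating measure. Then the following hold. (i) \[ \frac13 P_0\Bigl(\Bigl[\log\frac{p_0}{p}\Bigr]\mathbf{1}\Bigl\{\frac{p_0}{p}>4\Bigr\}\Bigr)\leq K(p_0\,\Vert\, p)\leq 3h(p_0,p)^2+P_0\Bigl(\Bigl[\log\frac{p_0}{p}\Bigr]\mathbf{1}\Bigl\{\frac{p_0}{p}>4\Bigr\}\Bigr). \] (ii) For every real $k\geq 2$, \[ P_0\Bigl(\Bigl[\log\frac{p_0}{p}\Bigr]^k\mathbf{1}\Bigl\{\frac{p_0}{p}>4\Bigr\}\Bigr)\leq V_k(p_0\,\Vert\, p)\leq 4\Bigl(\bigl[2(\log 4)^{k-2}\bigr]\vee\Bigl[\frac ke\Bigr]^k\Bigr)h(p_0,p)^2+P_0\Bigl(\Bigl[\log\frac{p_0}{p}\Bigr]^k\mathbf{1}\Bigl\{\frac{p_0}{p}>4\Bigr\}\Bigr). \] (iii) For all real $k'\geq k>0$, \[ P_0\Bigl(\Bigl[\log\frac{p_0}{p}\Bigr]^k\mathbf{1}\Bigl\{\frac{p_0}{p}>4\Bigr\}\Bigr)\leq 4\,h(p_0,p)^{2(1-\frac{k}{k'})}\Bigl[P_0\Bigl(\Bigl[\log\frac{p_0}{p}\Bigr]^{k'}\mathbf{1}\Bigl\{\frac{p_0}{p}>4\Bigr\}\Bigr)\Bigr]^{\frac{k}{k'}}. \]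
   Context: For a probability measure $P$ and measurable $f$, $Pf=P(f)=\int f\,dP$ denotes expectation. Densities are taken with respect to any $\sigma$-finite measure $\mu$ dominating both measures; all quantities below do not depend on the choice of $\mu$. $x\vee y=\max\{x,y\}$. Hellinger distance: $h(p,q)=\bigl[\int(\sqrt p-\sqrt q)^2\,d\mu\bigr]^{1/2}$ (no factor $1/2$). Kullback--Leibler divergence: $K(p\,\Vert\, q)=P\log\frac pq$. For $k>1$, the $k$th order Kullback--Leibler variation is $V_k(p\,\Vert\, q)=P\bigl|\log\frac pq\bigr|^k$. Conventions: all quantities take values in $[0,\infty]$. Events of $P_0$-probability zero (such as $\{p_0=0\}$) are ignored in $P_0$-integrals. Where $p_0>0$ and $p=0$, the ratio $p_0/p$ and its logarithm are $+\infty$, so if this set has positive $P_0$-probability the integrals above are understood to be $+\infty$. *)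

theory Defs
  imports "HOL-Probability.Probability"
begin

text \<open>
  Real powers on \<open>[0, \<infinity>]\<close>, intended for exponents \<open>a \<ge> 0\<close>. In contrast to \<open>powr\<close> on the reals,
  \<open>0\<close> raised to the power \<open>0\<close> is \<open>1\<close>.
\<close>
definition ennreal_powr :: "ennreal \<Rightarrow> real \<Rightarrow> ennreal"  (infixr "epowr" 80) where
  "x epowr a =
     (if a = 0 then 1 else if x = \<infinity> then \<infinity> else ennreal (enn2real x powr a))"

definition ennreal_ln :: "ennreal \<Rightarrow> ereal" where
  "ennreal_ln x =
     (if x = 0 then -\<infinity> else if x = \<infinity> then \<infinity> else ereal (ln (enn2real x)))"

text \<open>Division on \<open>ennreal\<close> gives \<open>\<infinity>\<close> where \<open>q x = 0 < p x\<close>.\<close>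
definition dens_ratio :: "('a \<Rightarrow> real) \<Rightarrow> ('a \<Rightarrow> real) \<Rightarrow> 'a \<Rightarrow> ennreal" where
  "dens_ratio p q x = ennreal (p x) / ennreal (q x)"

definition log_ratio :: "('a \<Rightarrow> real) \<Rightarrow> ('a \<Rightarrow> real) \<Rightarrow> 'a \<Rightarrow> ereal" where
  "log_ratio p q x = ennreal_ln (dens_ratio p q x)"

text \<open>
  The Lebesgue integral of an extended real function as the difference of the integrals of its
  positive and negative parts (\<open>e2ennreal\<close> maps negative numbers to \<open>0\<close>).
\<close>
definition ereal_integral :: "'a measure \<Rightarrow> ('a \<Rightarrow> ereal) \<Rightarrow> ereal" where
  "ereal_integral M f =
     enn2ereal (\<integral>\<^sup>+x. e2ennreal (f x) \<partial>M) - enn2ereal (\<integral>\<^sup>+x. e2ennreal (- f x) \<partial>M)"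

definition hellinger :: "'a measure \<Rightarrow> ('a \<Rightarrow> real) \<Rightarrow> ('a \<Rightarrow> real) \<Rightarrow> ennreal" where
  "hellinger \<mu> p q = (\<integral>\<^sup>+x. ennreal ((sqrt (p x) - sqrt (q x))\<^sup>2) \<partial>\<mu>) epowr (1/2)"

text \<open>
  The library's \<open>KL_divergence\<close> is real-valued and does not take the value \<open>\<infinity>\<close>, so it cannot be
  used here.
\<close>
definition KL_div :: "'a measure \<Rightarrow> ('a \<Rightarrow> real) \<Rightarrow> ('a \<Rightarrow> real) \<Rightarrow> ereal" where
  "KL_div \<mu> p q = ereal_integral (density \<mu> p) (log_ratio p q)"

definition KL_variation :: "real \<Rightarrow> 'a measure \<Rightarrow> ('a \<Rightarrow> real) \<Rightarrow> ('a \<Rightarrow> real) \<Rightarrow> ennreal" where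
  "KL_variation k \<mu> p q = (\<integral>\<^sup>+x. e2ennreal \<bar>log_ratio p q x\<bar> epowr k \<partial>density \<mu> p)"

end

theory Submission
  imports Defs
begin

text \<open>
  Write \<open>a = p\<^sub>0 x\<close>, \<open>b = p x\<close> and \<open>s = \<surd>(b / a)\<close>, so that \<open>(\<surd>a - \<surd>b)\<^sup>2 = a (s - 1)\<^sup>2\<close>,
  \<open>log (a / b) = - 2 log s\<close>, and \<open>a / b \<le> 4\<close> means \<open>s \<ge> 1 / 2\<close>. Parts (i) and (ii) are integrated
  pointwise inequalities in \<open>s\<close>. In (i) one compares \<open>a log (a / b)\<close> with the multiples of
  \<open>(\<surd>a - \<surd>b)\<^sup>2\<close> only up to the term \<open>a - b\<close>, which integrates to \<open>0\<close>; the upper bound then reads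
  \<open>log s \<ge> (s - 1) - (s - 1)\<^sup>2\<close> for \<open>s \<ge> 1 / 2\<close>. Part (iii) is Hoelder's inequality together with
  \<open>P\<^sub>0 (p\<^sub>0 / p > 4) \<le> 4 h\<^sup>2\<close>, which holds because \<open>\<surd>b < \<surd>a / 2\<close> on that event.
\<close>

section \<open>Real powers on the extended nonnegative reals\<close>

lemma ennreal_powr_ennreal [simp]:
  assumes "a \<noteq> 0" "0 \<le> x"
  shows "ennreal x epowr a = ennreal (x powr a)"
  using assms by (simp add: ennreal_powr_def)

lemma top_epowr [simp]: "a \<noteq> 0 \<Longrightarrow> \<top> epowr a = \<top>"
  by (simp add: ennreal_powr_def)

lemma zero_epowr [simp]: "a \<noteq> 0 \<Longrightarrow> 0 epowr a = 0"
  by (simp add: ennreal_powr_def)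

lemma one_epowr [simp]: "1 epowr a = 1"
  by (simp add: ennreal_powr_def)

lemma epowr_zero [simp]: "x epowr 0 = 1"
  by (simp add: ennreal_powr_def)

lemma epowr_one [simp]: "x epowr 1 = x"
  by (cases x) (auto simp: ennreal_powr_def)

lemma epowr_eq_0_iff: "x epowr a = 0 \<longleftrightarrow> x = 0 \<and> a \<noteq> 0"
  by (cases x) (auto simp: ennreal_powr_def)

lemma epowr_mono: "x \<le> y \<Longrightarrow> 0 \<le> a \<Longrightarrow> x epowr a \<le> y epowr a"
  by (cases x; cases y) (auto simp: ennreal_powr_def top_unique powr_mono2 ennreal_leI)

lemma epowr_epowr: "(x epowr a) epowr b = x epowr (a * b)"
  by (cases x) (auto simp: ennreal_powr_def powr_powr)

lemma epowr_mult: "0 < a \<Longrightarrow> (x * y) epowr a = x epowr a * y epowr a"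
  by (cases x; cases y; cases "x = 0"; cases "y = 0")
     (auto simp: powr_mult ennreal_mult_top ennreal_top_mult simp flip: ennreal_mult)

section \<open>Measurability of powers, ratios and logarithms\<close>

lemma measurable_epowr [measurable]:
  assumes [measurable]: "f \<in> borel_measurable M"
  shows "(\<lambda>x. f x epowr a) \<in> borel_measurable M"
  unfolding ennreal_powr_def by measurable

lemma measurable_ennreal_ln [measurable]:
  assumes [measurable]: "f \<in> borel_measurable M"
  shows "(\<lambda>x. ennreal_ln (f x)) \<in> borel_measurable M"
  unfolding ennreal_ln_def by measurable

lemma measurable_dens_ratio [measurable]:
  assumes [measurable]: "p \<in> borel_measurable M" "q \<in> borel_measurable M"
  shows "dens_ratio p q \<in> borel_measurable M"
proof -
  have "(\<lambda>x. dens_ratio p q x) \<in> borel_measurable M"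
    unfolding dens_ratio_def by measurable
  then show ?thesis .
qed

lemma measurable_log_ratio [measurable]:
  assumes [measurable]: "p \<in> borel_measurable M" "q \<in> borel_measurable M"
  shows "log_ratio p q \<in> borel_measurable M"
proof -
  have "(\<lambda>x. log_ratio p q x) \<in> borel_measurable M"
    unfolding log_ratio_def by measurable
  then show ?thesis .
qed

section \<open>Hoelder's inequality with values in \<open>[0, \<infinity>]\<close>\<close>

text \<open>After scaling both integrals to 1, the weighted inequality between geometric and
  arithmetic means integrates to the claim. Integrals equal to 0 or \<infinity> cannot be scaled and
  come first: the left side vanishes in the former case, and otherwise the right side is
  infinite.\<close>

lemma Holder_nn_integral:
  fixes f g :: "'a \<Rightarrow> ennreal"
  assumes [measurable]: "f \<in> borel_measurable M" "g \<in> borel_measurable M" and t: "0 < t" "t < 1"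
  shows "(\<integral>\<^sup>+x. f x epowr t * g x epowr (1 - t) \<partial>M)
    \<le> (\<integral>\<^sup>+x. f x \<partial>M) epowr t * (\<integral>\<^sup>+x. g x \<partial>M) epowr (1 - t)"
proof -
  define I J where "I = (\<integral>\<^sup>+x. f x \<partial>M)" and "J = (\<integral>\<^sup>+x. g x \<partial>M)"
  consider "I = 0 \<or> J = 0" | "I \<noteq> 0" "J \<noteq> 0" "I = \<top> \<or> J = \<top>"
    | "I \<noteq> 0" "J \<noteq> 0" "I \<noteq> \<top>" "J \<noteq> \<top>" by blast
  then show ?thesis
  proof cases
    case 1
    then have "(AE x in M. f x = 0) \<or> (AE x in M. g x = 0)"
      unfolding I_def J_def by (simp add: nn_integral_0_iff_AE)
    then have "AE x in M. f x epowr t * g x epowr (1 - t) = 0"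
      using t by (elim disjE) (auto elim!: eventually_mono simp: epowr_eq_0_iff)
    then have "(\<integral>\<^sup>+x. f x epowr t * g x epowr (1 - t) \<partial>M) = 0"
      by (subst nn_integral_0_iff_AE) auto
    then show ?thesis by simp
  next
    case 2
    then have "I epowr t * J epowr (1 - t) = \<top>"
      using t by (auto simp: ennreal_mult_eq_top_iff epowr_eq_0_iff)
    then show ?thesis by (simp add: I_def J_def)
  next
    case 3
    obtain i where i: "I = ennreal i" "i > 0"
      using 3 by (cases I) (auto simp: order_le_less)
    obtain j where j: "J = ennreal j" "j > 0"
      using 3 by (cases J) (auto simp: order_le_less)
    \<comment> \<open>\<open>c\<close> is the right-hand side of the claim. Multiplying the mean
      inequality for \<open>u / i\<close> and \<open>v / j\<close> by it leaves a linear bound whose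
      integral is \<open>c * t + c * (1 - t) = c\<close>.\<close>
    define c where "c = i powr t * j powr (1 - t)"
    have c: "c > 0" using i j by (simp add: c_def)
    have young: "f x epowr t * g x epowr (1 - t)
        \<le> ennreal (c * t / i) * f x + ennreal (c * (1 - t) / j) * g x" for x
    proof (cases "f x = \<top> \<or> g x = \<top>")
      case True
      then show ?thesis using i j t c by (auto simp: ennreal_mult_top)
    next
      case False
      then obtain u v where u: "f x = ennreal u" "u \<ge> 0" and v: "g x = ennreal v" "v \<ge> 0"
        by (cases "f x"; cases "g x") auto
      have "(u / i) powr t * (v / j) powr (1 - t) \<le> t * (u / i) + (1 - t) * (v / j)"
        using Youngs_inequality_0[of t "1 - t" "u / i" "v / j"] t u v i j
        by (cases "u = 0 \<or> v = 0") (auto simp: order_less_le)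
      then have "c * ((u / i) powr t * (v / j) powr (1 - t)) \<le> c * (t * (u / i) + (1 - t) * (v / j))"
        using c by (intro mult_left_mono) auto
      also have "c * ((u / i) powr t * (v / j) powr (1 - t)) = u powr t * v powr (1 - t)"
        using u v i j by (simp add: c_def powr_divide)
      also have "c * (t * (u / i) + (1 - t) * (v / j)) = c * t / i * u + c * (1 - t) / j * v"
        by (simp add: algebra_simps)
      finally show ?thesis
        using u v t i j c by (simp add: ennreal_leI flip: ennreal_mult ennreal_plus)
    qed
    have "(\<integral>\<^sup>+x. f x epowr t * g x epowr (1 - t) \<partial>M)
        \<le> (\<integral>\<^sup>+x. ennreal (c * t / i) * f x + ennreal (c * (1 - t) / j) * g x \<partial>M)"
      by (intro nn_integral_mono young)
    also have "\<dots> = ennreal (c * t / i) * I + ennreal (c * (1 - t) / j) * J"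
      by (simp add: nn_integral_add nn_integral_cmult I_def J_def)
    also have "\<dots> = ennreal (c * t / i * i + c * (1 - t) / j * j)"
      using t i j c by (simp flip: ennreal_mult ennreal_plus)
    also have "c * t / i * i + c * (1 - t) / j * j = c"
      using i j by (simp add: right_diff_distrib)
    also have "ennreal c = I epowr t * J epowr (1 - t)"
      using i j t by (simp add: c_def ennreal_mult)
    finally show ?thesis by (simp add: I_def J_def)
  qed
qed

section \<open>Values of the density ratio and its logarithm at a point\<close>

lemma log_ratio_pos:
  assumes "0 < p x" "0 < q x"
  shows "log_ratio p q x = ereal (ln (p x / q x))" "dens_ratio p q x = ennreal (p x / q x)"
proof -
  show "dens_ratio p q x = ennreal (p x / q x)"
    using assms by (simp add: dens_ratio_def divide_ennreal)
  then show "log_ratio p q x = ereal (ln (p x / q x))"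
    using assms by (simp add: log_ratio_def ennreal_ln_def)
qed

lemma log_ratio_zero:
  assumes "0 < p x" "q x = 0"
  shows "log_ratio p q x = \<infinity>" "dens_ratio p q x = \<top>"
  using assms by (simp_all add: dens_ratio_def log_ratio_def ennreal_ln_def ennreal_divide_zero)

lemma dens_ratio_gt_4_iff:
  assumes "0 < p x" "0 < q x"
  shows "dens_ratio p q x > 4 \<longleftrightarrow> p x > 4 * q x"
proof -
  have "dens_ratio p q x > 4 \<longleftrightarrow> ennreal 4 < ennreal (p x / q x)"
    using log_ratio_pos(2)[of p x q, OF assms] by simp
  also have "\<dots> \<longleftrightarrow> p x > 4 * q x"
    using assms by (simp add: ennreal_less_iff pos_less_divide_eq)
  finally show ?thesis .
qed

section \<open>Inequalities between real numbers\<close>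

text \<open>The first bound yields the factor 1/3 in (i); the second replaces two of the
  \<open>k\<close> factors \<open>ln 4\<close> by the constant 2 in (ii).\<close>

lemma ln_4_bounds: "9 / 8 \<le> ln (4::real)" "(ln (4::real))\<^sup>2 \<le> 2"
proof -
  have *: "ln (4::real) = 2 * ln 2" using ln_realpow[of 2 2] by simp
  show "9 / 8 \<le> ln (4::real)" using ln2_ge_two_thirds by (simp add: *)
  have "(ln (4::real))\<^sup>2 \<le> (25 / 18)\<^sup>2"
    using ln2_le_25_over_36 by (intro power_mono) (auto simp: *)
  then show "(ln (4::real))\<^sup>2 \<le> 2" by (simp add: power2_eq_square)
qed

text \<open>The difference of the two sides has derivative \<open>(y - 1) * (2 * y - 1) / y\<close>,
  so it falls on \<open>[1/2, 1]\<close>, rises from 1 on, and is 0 at 1. The root 1/2 of the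
  derivative corresponds to the threshold 4 for the ratio.\<close>

lemma ln_ge_quadratic:
  fixes s :: real
  assumes "1 / 2 \<le> s"
  shows "(s - 1) - (s - 1)\<^sup>2 \<le> ln s"
proof -
  define f where "f = (\<lambda>s::real. ln s - (s - 1) + (s - 1)\<^sup>2)"
  have deriv: "(f has_real_derivative ((y - 1) * (2 * y - 1) / y)) (at y)" if "y > 0" for y
    unfolding f_def using that
    by (auto intro!: derivative_eq_intros simp: field_simps power2_eq_square)
  have "f 1 \<le> f s"
  proof (cases "s \<ge> 1")
    case True
    then show ?thesis
    proof (rule DERIV_nonneg_imp_nondecreasing)
      fix y assume "1 \<le> y" "y \<le> s"
      then show "\<exists>d. (f has_real_derivative d) (at y) \<and> 0 \<le> d"
        by (intro exI[of _ "(y - 1) * (2 * y - 1) / y"] conjI deriv) auto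
    qed
  next
    case False
    then have "s \<le> 1" by simp
    then show ?thesis
    proof (rule DERIV_nonpos_imp_nonincreasing)
      fix y assume "s \<le> y" "y \<le> 1"
      then show "\<exists>d. (f has_real_derivative d) (at y) \<and> d \<le> 0"
        using assms
        by (intro exI[of _ "(y - 1) * (2 * y - 1) / y"] conjI deriv)
           (auto intro!: divide_nonpos_pos mult_nonpos_nonneg)
    qed
  qed
  then show ?thesis by (simp add: f_def)
qed

text \<open>The substitution that turns an inequality homogeneous in \<open>a\<close> and
  \<open>b\<close> into \<open>a\<close> times an inequality in the single variable
  \<open>s\<close>.\<close>

lemma sqrt_ratio:
  fixes a b :: real
  assumes "0 < a" "0 < b"
  defines "s \<equiv> sqrt b / sqrt a"
  shows "s > 0" "ln (a / b) = - 2 * ln s" "b = a * s\<^sup>2" "(sqrt a - sqrt b)\<^sup>2 = a * (s - 1)\<^sup>2"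
    "a \<le> 4 * b \<longleftrightarrow> 1 / 2 \<le> s"
proof -
  show s: "s > 0" using assms by simp
  show b: "b = a * s\<^sup>2" using assms by (simp add: s_def power_divide)
  have "a / b = 1 / s\<^sup>2" using s assms by (subst b) simp
  then show "ln (a / b) = - 2 * ln s" using s by (simp add: ln_div ln_realpow)
  have "sqrt b = sqrt a * s" using assms by (simp add: s_def)
  then have "sqrt a - sqrt b = sqrt a * (1 - s)" by (simp add: algebra_simps)
  then show "(sqrt a - sqrt b)\<^sup>2 = a * (s - 1)\<^sup>2"
    using assms by (simp add: power_mult_distrib power2_commute)
  have "4 * b = a * (2 * s)\<^sup>2" unfolding power_mult_distrib by (subst b) simp
  then have "a \<le> 4 * b \<longleftrightarrow> 1 \<le> (2 * s)\<^sup>2"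
    using assms(1) mult_le_cancel_left_pos[of a 1 "(2 * s)\<^sup>2"] by simp
  also have "\<dots> \<longleftrightarrow> 1 \<le> 2 * s"
    using s power_mono_iff[of 1 "2 * s" 2] by simp
  finally show "a \<le> 4 * b \<longleftrightarrow> 1 / 2 \<le> s" by auto
qed

text \<open>The constant is 3 = 2 + 1: the quadratic lower bound for \<open>ln s\<close> contributes
  \<open>2 * (s - 1)\<^sup>2\<close>, and completing the square in the remaining
  \<open>s\<^sup>2 - 2 * s\<close> contributes one more. The terms \<open>a\<close> and
  \<open>b\<close> stand on opposite sides so that no subtraction occurs after passing to
  \<open>ennreal\<close>.\<close>

lemma mult_ln_le_hellinger:
  fixes a b :: real
  assumes "0 < a" "0 < b" "a \<le> 4 * b"
  shows "a * ln (a / b) + b \<le> 3 * (sqrt a - sqrt b)\<^sup>2 + a"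
proof -
  define s where "s = sqrt b / sqrt a"
  note r = sqrt_ratio[OF assms(1,2), folded s_def]
  have "- 2 * ln s + s\<^sup>2 \<le> 3 * (s - 1)\<^sup>2 + 1"
    using ln_ge_quadratic[of s] r(5) assms(3) by (simp add: power2_eq_square algebra_simps)
  then have "a * (- 2 * ln s + s\<^sup>2) \<le> a * (3 * (s - 1)\<^sup>2 + 1)"
    using assms by (intro mult_left_mono) auto
  then show ?thesis unfolding r(2,4) using r(3) by (simp add: algebra_simps)
qed

text \<open>The tangent bound \<open>ln y \<le> y - 1\<close> at \<open>y = b / a\<close>,
  multiplied by \<open>a\<close>; its integral is the nonnegativity of the divergence.\<close>

lemma mult_ln_ge_diff:
  fixes a b :: real
  assumes "0 < a" "0 < b"
  shows "a \<le> a * ln (a / b) + b"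
proof -
  have "ln (b / a) \<le> b / a - 1" using assms by (intro ln_le_minus_one) auto
  then have "1 \<le> ln (a / b) + b / a" using assms by (simp add: ln_div)
  then have "a * 1 \<le> a * (ln (a / b) + b / a)" using assms by (intro mult_left_mono) auto
  then show ?thesis using assms by (simp add: algebra_simps)
qed

text \<open>The tangent bound is applied to \<open>4 * b\<close> instead of \<open>b\<close>, which
  makes it sharp at the boundary \<open>a = 4 * b\<close> of the region considered.\<close>

lemma mult_ln_ge_third:
  fixes a b :: real
  assumes "0 < a" "0 < b" "4 * b < a"
  shows "1 / 3 * (a * ln (a / b)) + a \<le> a * ln (a / b) + b"
proof -
  have "a \<le> a * ln (a / (4 * b)) + 4 * b" using assms by (intro mult_ln_ge_diff) auto
  also have "ln (a / (4 * b)) = ln (a / b) - ln 4" using assms by (simp add: ln_div ln_mult)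
  finally have 1: "a + a * ln 4 \<le> a * ln (a / b) + 4 * b" by (simp add: algebra_simps)
  \<comment> \<open>With 9/8 for \<open>ln 4\<close>, two thirds of \<open>a * ln (a / b)\<close>
    exceeds \<open>a - b\<close> by at least \<open>5/12 * (a - 4 * b)\<close>, which is positive.
    No smaller constant would do near \<open>a = 4 * b\<close>.\<close>
  have "a * (9 / 8) \<le> a * ln 4" using assms ln_4_bounds by (intro mult_left_mono) auto
  with 1 assms show ?thesis by linarith
qed

text \<open>The two entries of the maximum belong to two ranges of \<open>s\<close>. For
  \<open>s\<close> in \<open>[1/2, 2]\<close>, \<open>k - 2\<close> powers of the logarithm are
  bounded by powers of \<open>ln 4\<close> and the remaining square by
  \<open>8 * (s - 1)\<^sup>2\<close>. For \<open>s > 2\<close>, the logarithmic power is compared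
  with \<open>s\<^sup>2\<close>, at the cost of \<open>(k / exp 1) powr k\<close>.\<close>

lemma ln_powr_le_hellinger:
  fixes a b k :: real
  assumes ab: "0 < a" "0 < b" "a \<le> 4 * b" and k: "2 \<le> k"
  shows "a * \<bar>ln (a / b)\<bar> powr k
    \<le> 4 * max (2 * (ln 4) powr (k - 2)) ((k / exp 1) powr k) * (sqrt a - sqrt b)\<^sup>2"
proof -
  define s where "s = sqrt b / sqrt a"
  note r = sqrt_ratio[OF ab(1,2), folded s_def]
  define C where "C = max (2 * (ln 4) powr (k - 2)) ((k / exp 1) powr k)"
  have s: "1 / 2 \<le> s" using r(5) ab by simp
  have ln4: "ln (4::real) = 2 * ln 2" using ln_realpow[of 2 2] by simp
  have "\<bar>2 * ln s\<bar> powr k \<le> 4 * C * (s - 1)\<^sup>2"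
  proof (cases "s \<le> 2")
    case True
    have le: "\<bar>2 * ln s\<bar> \<le> ln 4"
    proof -
      have "ln s \<le> ln 2" using s True by simp
      moreover have "ln (1 / 2) \<le> ln s" using s by (subst ln_le_cancel_iff) auto
      ultimately show ?thesis by (auto simp: ln4 ln_div abs_le_iff)
    qed
    have sq: "\<bar>2 * ln s\<bar> \<le> 2 * ln 4 * \<bar>s - 1\<bar>"
    proof (cases "s \<ge> 1")
      case True
      have "ln s \<le> s - 1" using s by (intro ln_le_minus_one) auto
      also have "\<dots> \<le> ln 4 * (s - 1)"
        using True ln_4_bounds mult_right_mono[of 1 "ln 4" "s - 1"] by simp
      finally show ?thesis using True by simp
    next
      case False
      \<comment> \<open>By concavity the logarithm lies above its chord over
        \<open>[1/2, 1]\<close>; \<open>2 * s - 1\<close> is the weight of 1 when \<open>s\<close>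
        is written as a convex combination of the endpoints.\<close>
      have "(1 - (2 * s - 1)) * ln (1 / 2) + (2 * s - 1) * ln 1
          \<le> ln ((1 - (2 * s - 1)) *\<^sub>R (1 / 2) + (2 * s - 1) *\<^sub>R (1::real))"
        using s False by (intro concave_onD[OF ln_concave]) auto
      then show ?thesis using s False by (simp add: ln4 ln_div algebra_simps)
    qed
    have "\<bar>2 * ln s\<bar> powr k = \<bar>2 * ln s\<bar> powr (k - 2) * \<bar>2 * ln s\<bar> powr 2"
      using powr_add[of "\<bar>2 * ln s\<bar>" "k - 2" 2] by simp
    also have "\<dots> \<le> ln 4 powr (k - 2) * (2 * ln 4 * \<bar>s - 1\<bar>) powr 2"
      using le sq k by (intro mult_mono powr_mono2) auto
    also have "(2 * ln 4 * \<bar>s - 1\<bar>) powr 2 = 4 * (ln 4)\<^sup>2 * (s - 1)\<^sup>2"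
      by (simp add: power_mult_distrib)
    also have "\<dots> \<le> 4 * 2 * (s - 1)\<^sup>2"
      using ln_4_bounds by (intro mult_right_mono) auto
    finally have "\<bar>2 * ln s\<bar> powr k \<le> 4 * (2 * ln 4 powr (k - 2)) * (s - 1)\<^sup>2"
      by (simp add: mult_left_mono algebra_simps)
    also have "\<dots> \<le> 4 * C * (s - 1)\<^sup>2"
      by (intro mult_right_mono mult_left_mono) (auto simp: C_def)
    finally show ?thesis .
  next
    case False
    \<comment> \<open>The exponent is chosen so that \<open>u powr k = s\<^sup>2\<close>. The bound
      \<open>ln u \<le> u / exp 1\<close> is the tangent to the logarithm at
      \<open>exp 1\<close>.\<close>
    define u where "u = s powr (2 / k)"
    have "u > 0" using s by (simp add: u_def)
    have "ln (u / exp 1) \<le> u / exp 1 - 1" using \<open>u > 0\<close> by (intro ln_le_minus_one) auto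
    then have "ln u \<le> u / exp 1" using \<open>u > 0\<close> by (simp add: ln_div)
    moreover have "ln u = 2 * ln s / k" using s by (simp add: u_def ln_powr)
    ultimately have "2 * ln s \<le> k / exp 1 * u" using k by (simp add: field_simps)
    then have "\<bar>2 * ln s\<bar> powr k \<le> (k / exp 1 * u) powr k"
      using k False by (intro powr_mono2) auto
    also have "\<dots> = (k / exp 1) powr k * s\<^sup>2"
      using k s powr_mult[of "k / exp 1" u k] by (simp add: u_def powr_powr)
    \<comment> \<open>Here \<open>s > 2\<close> gives \<open>s \<le> 2 * (s - 1)\<close>.\<close>
    also have "\<dots> \<le> C * (2 * (s - 1))\<^sup>2"
      using False by (intro mult_mono power_mono) (auto simp: C_def le_max_iff_disj)
    finally show ?thesis unfolding power_mult_distrib by (simp add: mult_ac)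
  qed
  then have "a * \<bar>2 * ln s\<bar> powr k \<le> a * (4 * C * (s - 1)\<^sup>2)"
    using ab by (intro mult_left_mono) auto
  then show ?thesis unfolding r(2,4) by (simp add: C_def mult_ac)
qed

lemma le_4_hellinger:
  fixes a b :: real
  assumes "0 \<le> b" "4 * b < a"
  shows "a \<le> 4 * (sqrt a - sqrt b)\<^sup>2"
proof -
  have "sqrt (4 * b) \<le> sqrt a" using assms by simp
  then have "sqrt a \<le> 2 * (sqrt a - sqrt b)" by (simp add: real_sqrt_mult)
  then have "(sqrt a)\<^sup>2 \<le> (2 * (sqrt a - sqrt b))\<^sup>2" using assms by (intro power_mono) auto
  then show ?thesis using assms unfolding power_mult_distrib by simp
qed

section \<open>Pointwise inequalities for the integrands in \<open>[0, \<infinity>]\<close>\<close>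

context
  fixes p q :: "'a \<Rightarrow> real" and x :: 'a
  assumes nonneg: "0 \<le> p x" "0 \<le> q x"
begin

text \<open>\<open>p\<close> and \<open>q\<close> stand for \<open>p0\<close> and \<open>p\<close>
  of the theorem. Where \<open>p x = 0\<close>, the factor \<open>p x\<close> annihilates every
  integrand against the first measure, so nothing about the ratio is recorded there.\<close>

lemma density_cases:
  obtains "p x = 0"
  | "0 < p x" "q x = 0" "log_ratio p q x = \<infinity>" "4 < dens_ratio p q x"
  | "0 < p x" "0 < q x" "log_ratio p q x = ereal (ln (p x / q x))" "4 < dens_ratio p q x"
    "4 * q x < p x" "0 < ln (p x / q x)"
  | "0 < p x" "0 < q x" "log_ratio p q x = ereal (ln (p x / q x))" "\<not> 4 < dens_ratio p q x"
    "p x \<le> 4 * q x"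
proof -
  consider "p x = 0" | "0 < p x" "q x = 0" | "0 < p x" "0 < q x" "4 * q x < p x"
    | "0 < p x" "0 < q x" "p x \<le> 4 * q x"
    using nonneg by fastforce
  then show ?thesis
  proof cases
    case 1 then show ?thesis by (rule that(1))
  next
    case 2
    moreover have "4 < dens_ratio p q x" using log_ratio_zero(2)[of p x q] 2 by simp
    ultimately show ?thesis using log_ratio_zero(1)[of p x q] that(2) by simp
  next
    case 3
    then show ?thesis
      using log_ratio_pos(1)[of p x q] dens_ratio_gt_4_iff[of p x q] that(3) by simp
  next
    case 4
    then show ?thesis
      using log_ratio_pos(1)[of p x q] dens_ratio_gt_4_iff[of p x q] that(4) by simp
  qed
qed

text \<open>The negative part of the logarithm and \<open>q x\<close> change sides to avoid
  subtraction. Above the threshold the truncated term equals the logarithmic term on the left and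
  \<open>q x \<le> p x\<close>; below it \<open>mult_ln_le_hellinger\<close> applies.\<close>

lemma KL_integrand_upper:
  "ennreal (p x) * e2ennreal (log_ratio p q x) + ennreal (q x)
    \<le> 3 * ennreal ((sqrt (p x) - sqrt (q x))\<^sup>2) + ennreal (p x)
      + ennreal (p x) * (e2ennreal (log_ratio p q x) * indicator {x. dens_ratio p q x > 4} x)
      + ennreal (p x) * e2ennreal (- log_ratio p q x)"
proof (cases rule: density_cases)
  case 1
  \<comment> \<open>At \<open>p x = 0\<close> the Hellinger integrand is \<open>q x\<close>
    itself.\<close>
  have "ennreal (q x) \<le> 3 * ennreal (q x)"
    using mult_right_mono[of 1 3 "ennreal (q x)"] by simp
  with 1 show ?thesis using nonneg by simp
next
  case 2
  then show ?thesis by (simp add: ennreal_mult_top)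
next
  case 3
  then have "ennreal (q x) \<le> ennreal (p x)" using nonneg by (intro ennreal_leI) auto
  with 3 show ?thesis
    by (simp add: add.commute add.left_commute add_left_mono add_increasing add_increasing2)
next
  case 4
  define l where "l = ln (p x / q x)"
  have "p x * l + q x \<le> 3 * (sqrt (p x) - sqrt (q x))\<^sup>2 + p x"
    unfolding l_def using 4 by (intro mult_ln_le_hellinger)
  \<comment> \<open>\<open>max 0 l\<close> and \<open>max 0 (- l)\<close> are the real forms of the
    two \<open>e2ennreal\<close> terms, and their difference is \<open>l\<close>.\<close>
  then have "p x * max 0 l + q x \<le> 3 * (sqrt (p x) - sqrt (q x))\<^sup>2 + p x + p x * max 0 (- l)"
    by (auto simp: max_def)
  then have "ennreal (p x * max 0 l + q x)
      \<le> ennreal (3 * (sqrt (p x) - sqrt (q x))\<^sup>2 + p x + p x * max 0 (- l))"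
    by (rule ennreal_leI)
  then show ?thesis using 4 nonneg
    by (simp add: ennreal_mult ennreal_plus flip: l_def)
qed

text \<open>Above the threshold the negative part is 0 and \<open>mult_ln_ge_third\<close> applies;
  below it the truncated term is 0 and \<open>mult_ln_ge_diff\<close> suffices.\<close>

lemma KL_integrand_lower:
  "ennreal (1 / 3) * (ennreal (p x) * (e2ennreal (log_ratio p q x) * indicator {x. dens_ratio p q x > 4} x))
      + ennreal (p x) + ennreal (p x) * e2ennreal (- log_ratio p q x)
    \<le> ennreal (p x) * e2ennreal (log_ratio p q x) + ennreal (q x)"
proof (cases rule: density_cases)
  case 1
  then show ?thesis by simp
next
  case 2
  then show ?thesis by (simp add: ennreal_mult_top)
next
  case 3
  define c :: real where "c = 1 / 3"
  have "0 \<le> c" by (simp add: c_def)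
  have "ennreal (c * (p x * ln (p x / q x)) + p x) \<le> ennreal (p x * ln (p x / q x) + q x)"
    unfolding c_def using 3 by (intro ennreal_leI mult_ln_ge_third) auto
  moreover have "e2ennreal (- ereal (ln (p x / q x))) = 0" using 3 by (simp add: ennreal_neg)
  ultimately show ?thesis
    using 3 nonneg \<open>0 \<le> c\<close> unfolding c_def[symmetric] by (simp add: ennreal_mult ennreal_plus)
next
  case 4
  define l where "l = ln (p x / q x)"
  have "p x \<le> p x * l + q x"
    unfolding l_def using 4 by (intro mult_ln_ge_diff)
  then have "p x + p x * max 0 (- l) \<le> p x * max 0 l + q x"
    by (auto simp: max_def)
  then have "ennreal (p x + p x * max 0 (- l)) \<le> ennreal (p x * max 0 l + q x)"
    by (rule ennreal_leI)
  then show ?thesis using 4 nonneg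
    by (simp add: ennreal_mult ennreal_plus flip: l_def)
qed

text \<open>Bounds the integral of the negative part by the total mass of the second
  density.\<close>

lemma neg_log_integrand_le:
  "ennreal (p x) * e2ennreal (- log_ratio p q x) \<le> ennreal (q x)"
proof (cases rule: density_cases)
  case 1
  then show ?thesis by simp
next
  case 2
  then show ?thesis by (simp add: e2ennreal_neg)
next
  case 3
  then show ?thesis by (simp add: ennreal_neg)
next
  case 4
  have "p x * - ln (p x / q x) \<le> q x"
    using mult_ln_ge_diff[of "p x" "q x"] 4 by (simp add: algebra_simps)
  then have "ennreal (p x * - ln (p x / q x)) \<le> ennreal (q x)" by (rule ennreal_leI)
  also have "ennreal (p x * - ln (p x / q x)) = ennreal (p x) * ennreal (- ln (p x / q x))"
    using nonneg by (intro ennreal_mult') auto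
  finally show ?thesis using 4 by simp
qed

text \<open>Above the threshold the logarithm is positive, so the truncated term already equals the
  left side; below it \<open>ln_powr_le_hellinger\<close> supplies the Hellinger term.\<close>

lemma KL_variation_integrand_upper:
  assumes "2 \<le> k"
  shows "ennreal (p x) * (e2ennreal \<bar>log_ratio p q x\<bar> epowr k)
    \<le> 4 * ennreal (max (2 * (ln 4) powr (k - 2)) ((k / exp 1) powr k))
        * ennreal ((sqrt (p x) - sqrt (q x))\<^sup>2)
      + ennreal (p x) * ((e2ennreal (log_ratio p q x) epowr k) * indicator {x. dens_ratio p q x > 4} x)"
proof (cases rule: density_cases)
  case 1
  then show ?thesis by simp
next
  case 2
  then show ?thesis using assms by (simp add: ennreal_mult_top)
next
  case 3
  then show ?thesis using assms by (simp add: add_increasing)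
next
  case 4
  define C where "C = max (2 * (ln 4) powr (k - 2)) ((k / exp 1) powr k)"
  have C: "0 \<le> C" by (simp add: C_def le_max_iff_disj)
  have "ennreal (p x * \<bar>ln (p x / q x)\<bar> powr k) \<le> ennreal (4 * C * (sqrt (p x) - sqrt (q x))\<^sup>2)"
    unfolding C_def using 4 assms by (intro ennreal_leI ln_powr_le_hellinger) auto
  then show ?thesis
    using 4 assms nonneg C unfolding C_def[symmetric] by (simp add: ennreal_mult)
qed

text \<open>Integrates to the bound on the probability of a ratio above 4, the second Hoelder factor
  in (iii).\<close>

lemma indicator_le_hellinger_integrand:
  "ennreal (p x) * indicator {x. dens_ratio p q x > 4} x \<le> 4 * ennreal ((sqrt (p x) - sqrt (q x))\<^sup>2)"
proof -
  have *: "ennreal (p x) \<le> 4 * ennreal ((sqrt (p x) - sqrt (q x))\<^sup>2)" if "4 * q x < p x"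
  proof -
    have "ennreal (p x) \<le> ennreal (4 * (sqrt (p x) - sqrt (q x))\<^sup>2)"
      using that nonneg by (intro ennreal_leI le_4_hellinger) auto
    then show ?thesis by (simp add: ennreal_mult)
  qed
  show ?thesis
    by (cases rule: density_cases) (use * nonneg in auto)
qed

end

section \<open>Powers of the Hellinger distance, and cancellation\<close>

lemma hellinger_power2:
  "(hellinger \<mu> p q)\<^sup>2 = (\<integral>\<^sup>+x. ennreal ((sqrt (p x) - sqrt (q x))\<^sup>2) \<partial>\<mu>)" (is "_ = ?H")
proof (cases ?H)
  case (real h)
  then show ?thesis
    by (simp add: hellinger_def powr_half_sqrt ennreal_power)
next
  case top
  then show ?thesis by (simp add: hellinger_def power2_eq_square)
qed

lemma hellinger_epowr:
  "hellinger \<mu> p q epowr (2 * a) = (hellinger \<mu> p q)\<^sup>2 epowr a"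
  unfolding hellinger_power2 by (simp add: hellinger_def epowr_epowr)

text \<open>The summand has the form \<open>ennreal r\<close> because an infinite one cannot be
  cancelled.\<close>

lemma ennreal_add_le_cancel_real:
  fixes a b :: ennreal
  assumes "a + ennreal r \<le> b + ennreal r"
  shows "a \<le> b"
  using assms ennreal_add_left_cancel_le[of "ennreal r" a b] by (simp add: add.commute)

section \<open>Integration of the pointwise inequalities\<close>

theorem theorem2:
  fixes \<mu> P0 P :: "'a measure" and p0 p :: "'a \<Rightarrow> real"
  assumes "sigma_finite_measure \<mu>"
    and "prob_space P0" and "prob_space P"
    and "p0 \<in> borel_measurable \<mu>" and "AE x in \<mu>. 0 \<le> p0 x" and "P0 = density \<mu> p0"
    and "p \<in> borel_measurable \<mu>" and "AE x in \<mu>. 0 \<le> p x" and "P = density \<mu> p"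
  shows
    "(ereal (1/3) *
        enn2ereal (\<integral>\<^sup>+x. e2ennreal (log_ratio p0 p x) * indicator {x. dens_ratio p0 p x > 4} x \<partial>P0)
        \<le> KL_div \<mu> p0 p
      \<and> KL_div \<mu> p0 p
        \<le> 3 * enn2ereal ((hellinger \<mu> p0 p)\<^sup>2) +
          enn2ereal (\<integral>\<^sup>+x. e2ennreal (log_ratio p0 p x) * indicator {x. dens_ratio p0 p x > 4} x \<partial>P0))
   \<and> (\<forall>k::real. k \<ge> 2 \<longrightarrow>
        (\<integral>\<^sup>+x. (e2ennreal (log_ratio p0 p x) epowr k) * indicator {x. dens_ratio p0 p x > 4} x \<partial>P0)
        \<le> KL_variation k \<mu> p0 p
      \<and> KL_variation k \<mu> p0 p
        \<le> 4 * ennreal (max (2 * (ln 4) powr (k - 2)) ((k / exp 1) powr k)) * (hellinger \<mu> p0 p)\<^sup>2 +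
          (\<integral>\<^sup>+x. (e2ennreal (log_ratio p0 p x) epowr k) * indicator {x. dens_ratio p0 p x > 4} x \<partial>P0))
   \<and> (\<forall>k k'::real. 0 < k \<and> k \<le> k' \<longrightarrow>
        (\<integral>\<^sup>+x. (e2ennreal (log_ratio p0 p x) epowr k) * indicator {x. dens_ratio p0 p x > 4} x \<partial>P0)
        \<le> 4 * (hellinger \<mu> p0 p epowr (2 * (1 - k / k'))) *
          ((\<integral>\<^sup>+x. (e2ennreal (log_ratio p0 p x) epowr k') * indicator {x. dens_ratio p0 p x > 4} x \<partial>P0)
             epowr (k / k')))"
proof -
  note [measurable] = assms(4,7)
  define A where "A = {x. dens_ratio p0 p x > 4}"
  define L where "L = log_ratio p0 p"
  define H where "H = (\<integral>\<^sup>+x. ennreal ((sqrt (p0 x) - sqrt (p x))\<^sup>2) \<partial>\<mu>)"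
  have L[measurable]: "L \<in> borel_measurable \<mu>" unfolding L_def by measurable
  have A[measurable]: "(indicator A :: 'a \<Rightarrow> ennreal) \<in> borel_measurable \<mu>"
    unfolding A_def by (rule borel_measurable_indicator') measurable
  have P0: "(\<integral>\<^sup>+x. f x \<partial>P0) = (\<integral>\<^sup>+x. ennreal (p0 x) * f x \<partial>\<mu>)" if "f \<in> borel_measurable \<mu>" for f
    unfolding assms(6) using that by (intro nn_integral_density) auto
  have nn: "AE x in \<mu>. 0 \<le> p0 x \<and> 0 \<le> p x" using assms(5,8) by eventually_elim simp
  \<comment> \<open>The mass is written \<open>ennreal 1\<close> to fit the cancellation of finite
    summands.\<close>
  have p0_1: "(\<integral>\<^sup>+x. ennreal (p0 x) \<partial>\<mu>) = ennreal 1"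
  proof -
    have "(\<integral>\<^sup>+x. 1 \<partial>P0) = 1" using prob_space.emeasure_space_1[OF assms(2)] by simp
    then show ?thesis by (subst (asm) P0) auto
  qed
  have p_1: "(\<integral>\<^sup>+x. ennreal (p x) \<partial>\<mu>) = ennreal 1"
  proof -
    have "(\<integral>\<^sup>+x. 1 \<partial>P) = 1" using prob_space.emeasure_space_1[OF assms(3)] by simp
    then show ?thesis unfolding assms(9) by (subst (asm) nn_integral_density) auto
  qed
  have hell: "(hellinger \<mu> p0 p)\<^sup>2 = H" by (simp add: hellinger_power2 H_def)

  \<comment> \<open>Part (i): bounds for the Kullback-Leibler divergence\<close>
  define B where "B = (\<integral>\<^sup>+x. e2ennreal (L x) * indicator A x \<partial>P0)"
  define U where "U = (\<integral>\<^sup>+x. e2ennreal (L x) \<partial>P0)"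
  define N where "N = (\<integral>\<^sup>+x. e2ennreal (- L x) \<partial>P0)"
  have B': "B = (\<integral>\<^sup>+x. ennreal (p0 x) * (e2ennreal (L x) * indicator A x) \<partial>\<mu>)"
    unfolding B_def by (rule P0) measurable
  have U': "U = (\<integral>\<^sup>+x. ennreal (p0 x) * e2ennreal (L x) \<partial>\<mu>)"
    unfolding U_def by (rule P0) measurable
  have N': "N = (\<integral>\<^sup>+x. ennreal (p0 x) * e2ennreal (- L x) \<partial>\<mu>)"
    unfolding N_def by (rule P0) measurable
  have "N \<le> (\<integral>\<^sup>+x. ennreal (p x) \<partial>\<mu>)"
    unfolding N' L_def
    by (rule nn_integral_mono_AE) (use nn in \<open>eventually_elim, auto intro: neg_log_integrand_le\<close>)
  \<comment> \<open>The negative part has finite integral, so \<open>U - N\<close> is meaningful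
    even for infinite \<open>U\<close>, and \<open>N\<close> may be moved across inequalities in
    \<open>ereal\<close>.\<close>
  then obtain n where n: "N = ennreal n" "0 \<le> n"
    unfolding p_1 by (cases N) (auto simp: top_unique)
  have "(\<integral>\<^sup>+x. ennreal (p0 x) * e2ennreal (L x) + ennreal (p x) \<partial>\<mu>)
      \<le> (\<integral>\<^sup>+x. 3 * ennreal ((sqrt (p0 x) - sqrt (p x))\<^sup>2) + ennreal (p0 x)
          + ennreal (p0 x) * (e2ennreal (L x) * indicator A x) + ennreal (p0 x) * e2ennreal (- L x) \<partial>\<mu>)"
    unfolding L_def A_def
    by (rule nn_integral_mono_AE) (use nn in \<open>eventually_elim, blast intro: KL_integrand_upper\<close>)
  \<comment> \<open>The two densities have the same mass, so the terms \<open>p x\<close> on the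
    left and \<open>p0 x\<close> on the right cancel after integration.\<close>
  then have "U + ennreal 1 \<le> 3 * H + ennreal 1 + B + N"
    by (simp add: nn_integral_add nn_integral_cmult p_1 p0_1 flip: U' N' B' H_def)
  then have "U + ennreal 1 \<le> (3 * H + B + N) + ennreal 1"
    by (simp add: add_ac)
  then have upper: "U \<le> 3 * H + B + N" by (rule ennreal_add_le_cancel_real)
  have "(\<integral>\<^sup>+x. ennreal (1 / 3) * (ennreal (p0 x) * (e2ennreal (L x) * indicator A x)) + ennreal (p0 x)
          + ennreal (p0 x) * e2ennreal (- L x) \<partial>\<mu>)
      \<le> (\<integral>\<^sup>+x. ennreal (p0 x) * e2ennreal (L x) + ennreal (p x) \<partial>\<mu>)"
    unfolding L_def A_def
    by (rule nn_integral_mono_AE) (use nn in \<open>eventually_elim, blast intro: KL_integrand_lower\<close>)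
  then have "ennreal (1 / 3) * B + ennreal 1 + N \<le> U + ennreal 1"
    by (simp add: nn_integral_add nn_integral_cmult p_1 p0_1 del: ennreal_1 flip: U' N' B' H_def)
  then have "ennreal (1 / 3) * B + N + ennreal 1 \<le> U + ennreal 1"
    by (simp add: add_ac)
  then have lower: "ennreal (1 / 3) * B + N \<le> U" by (rule ennreal_add_le_cancel_real)
  have KL: "KL_div \<mu> p0 p = enn2ereal U - enn2ereal N"
    by (simp add: KL_div_def ereal_integral_def U_def N_def L_def assms(6))
  have N_ereal: "enn2ereal N = ereal n" using n by simp
  have KL_lower: "ereal (1/3) * enn2ereal B \<le> KL_div \<mu> p0 p"
  proof -
    have "enn2ereal (ennreal (1 / 3) * B + N) \<le> enn2ereal U"
      using lower by (simp add: less_eq_ennreal.rep_eq)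
    then have "ereal (1/3) * enn2ereal B + ereal n \<le> enn2ereal U"
      using n by (simp add: plus_ennreal.rep_eq times_ennreal.rep_eq)
    then show ?thesis unfolding KL N_ereal by (subst ereal_le_minus) auto
  qed
  have KL_upper: "KL_div \<mu> p0 p \<le> 3 * enn2ereal H + enn2ereal B"
  proof -
    have "enn2ereal U \<le> enn2ereal (3 * H + B + N)"
      using upper by (simp add: less_eq_ennreal.rep_eq)
    then have "enn2ereal U \<le> 3 * enn2ereal H + enn2ereal B + ereal n"
      using n by (simp add: plus_ennreal.rep_eq times_ennreal.rep_eq)
    then show ?thesis unfolding KL N_ereal by (subst ereal_minus_le) auto
  qed

  \<comment> \<open>Part (ii): bounds for the Kullback-Leibler variation\<close>
  define B' where "B' k = (\<integral>\<^sup>+x. (e2ennreal (L x) epowr k) * indicator A x \<partial>P0)" for k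
  have V: "KL_variation k \<mu> p0 p = (\<integral>\<^sup>+x. e2ennreal \<bar>L x\<bar> epowr k \<partial>P0)" for k
    by (simp add: KL_variation_def L_def assms(6))
  have "y \<le> \<bar>y\<bar>" for y :: ereal by (cases y) auto
  then have V_lower: "B' k \<le> KL_variation k \<mu> p0 p" if "2 \<le> k" for k
    unfolding B'_def V using that
    by (intro nn_integral_mono)
       (auto simp: indicator_def intro!: epowr_mono e2ennreal_mono)
  have V_upper: "KL_variation k \<mu> p0 p
      \<le> 4 * ennreal (max (2 * (ln 4) powr (k - 2)) ((k / exp 1) powr k)) * H + B' k"
    if k: "2 \<le> k" for k
  proof -
    define C where "C = 4 * ennreal (max (2 * (ln 4) powr (k - 2)) ((k / exp 1) powr k))"
    have "KL_variation k \<mu> p0 p = (\<integral>\<^sup>+x. ennreal (p0 x) * (e2ennreal \<bar>L x\<bar> epowr k) \<partial>\<mu>)"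
      unfolding V by (rule P0) measurable
    also have "\<dots> \<le> (\<integral>\<^sup>+x. C * ennreal ((sqrt (p0 x) - sqrt (p x))\<^sup>2)
        + ennreal (p0 x) * ((e2ennreal (L x) epowr k) * indicator A x) \<partial>\<mu>)"
      unfolding L_def A_def C_def
      by (rule nn_integral_mono_AE)
         (use nn in \<open>eventually_elim, blast intro: KL_variation_integrand_upper[OF _ _ k]\<close>)
    also have "\<dots> = C * H + (\<integral>\<^sup>+x. ennreal (p0 x) * ((e2ennreal (L x) epowr k) * indicator A x) \<partial>\<mu>)"
      by (simp add: nn_integral_add nn_integral_cmult H_def)
    also have "(\<integral>\<^sup>+x. ennreal (p0 x) * ((e2ennreal (L x) epowr k) * indicator A x) \<partial>\<mu>) = B' k"
      unfolding B'_def by (rule P0[symmetric]) measurable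
    finally show ?thesis by (simp add: C_def)
  qed

  \<comment> \<open>Part (iii): interpolation between truncated moments\<close>
  have tail: "(\<integral>\<^sup>+x. indicator A x \<partial>P0) \<le> 4 * H"
  proof -
    have "(\<integral>\<^sup>+x. indicator A x \<partial>P0) = (\<integral>\<^sup>+x. ennreal (p0 x) * indicator A x \<partial>\<mu>)"
      by (rule P0) measurable
    also have "\<dots> \<le> (\<integral>\<^sup>+x. 4 * ennreal ((sqrt (p0 x) - sqrt (p x))\<^sup>2) \<partial>\<mu>)"
      unfolding A_def
      by (rule nn_integral_mono_AE)
         (use nn in \<open>eventually_elim, blast intro: indicator_le_hellinger_integrand\<close>)
    finally show ?thesis by (simp add: nn_integral_cmult H_def)
  qed
  have interp: "B' k \<le> 4 * (hellinger \<mu> p0 p epowr (2 * (1 - k / k'))) * (B' k' epowr (k / k'))"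
    if k: "0 < k" "k \<le> k'" for k k'
  proof (cases "k = k'")
    \<comment> \<open>The Hoelder weight would be 1, outside the open interval. The Hellinger factor
      has exponent 0 and equals 1 by the convention for \<open>epowr\<close>, even if the distance
      is 0.\<close>
    case True
    then show ?thesis using k mult_right_mono[of 1 4 "B' k"] by simp
  next
    case False
    define t where "t = k / k'"
    have t: "0 < t" "t < 1" "k' * t = k" using k False by (auto simp: t_def)
    have sets: "sets P0 = sets \<mu>" by (simp add: assms(6))
    \<comment> \<open>Positive powers leave an indicator unchanged, so each Hoelder factor receives
      its own copy; \<open>k' * t = k\<close> restores the power of the logarithm.\<close>
    have "B' k = (\<integral>\<^sup>+x. ((e2ennreal (L x) epowr k') * indicator A x) epowr t * indicator A x epowr (1 - t) \<partial>P0)"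
      unfolding B'_def using t
      by (intro nn_integral_cong) (auto simp: epowr_epowr indicator_def)
    also have "\<dots> \<le> B' k' epowr t * (\<integral>\<^sup>+x. indicator A x \<partial>P0) epowr (1 - t)"
      unfolding B'_def using t(1,2)
      by (intro Holder_nn_integral) (auto simp: measurable_cong_sets[OF sets refl])
    also have "\<dots> \<le> B' k' epowr t * (4 * H epowr (1 - t))"
    proof (intro mult_left_mono)
      have "(\<integral>\<^sup>+x. indicator A x \<partial>P0) epowr (1 - t) \<le> (4 * H) epowr (1 - t)"
        using tail t by (intro epowr_mono) auto
      also have "\<dots> = 4 epowr (1 - t) * H epowr (1 - t)" using t by (intro epowr_mult) auto
      \<comment> \<open>The tail bound gives the factor \<open>4 epowr (1 - t)\<close>; enlarging it
        to 4 makes the constant independent of \<open>k\<close> and \<open>k'\<close>.\<close>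
      also have "4 epowr (1 - t) \<le> 4"
      proof -
        have "ennreal (4 powr (1 - t)) \<le> ennreal (4 powr 1)"
          using t by (intro ennreal_leI powr_mono) auto
        then show ?thesis using ennreal_powr_ennreal[of "1 - t" 4] t by simp
      qed
      finally show "(\<integral>\<^sup>+x. indicator A x \<partial>P0) epowr (1 - t) \<le> 4 * H epowr (1 - t)"
        by (simp add: mult_right_mono)
    qed simp
    finally show ?thesis
      unfolding hellinger_epowr hell t_def by (simp add: mult_ac)
  qed
  show ?thesis
    using KL_lower KL_upper V_lower V_upper interp
    unfolding hell B_def B'_def L_def A_def by blast
qed

end
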